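(* Let $K$ be a field, $S=K[x_1,\ldots,x_n]$, $s\ge 2$, and let $I=\bigcap_{i=1}^s P_i$ be an irredundant intersection of monomial prime ideals of $S$ with $\sum_{i=1}^s P_i=(x_1,\ldots,x_n)$. Let $r<n$ be a positive integer and suppose that one of the prime ideals $P_i$ is generated by some of the first $r$ variables $x_1,\ldots,x_r$. With $\mathcal F$, $A_0$ and $A_\tau$ ($\tau\in\mathcal F$) defined as in the context, $$\operatorname{sdepth}_S I\geq \min\big(\{A_0\}\cup\{A_\tau\}_{\tau\in\mathcal F}\big).$$
   Context: A monomial prime ideal of $S$ is an ideal generated by a subset of the variables; an intersection $\bigcap_i P_i$ is irredundant if no $P_i$ can be omitted without changing it. Write $[s]=\{1,\ldots,s\}$ and $S'=K[x_{r+1},\ldots,x_n]$. For a subset $\tau\subset[s]$ set $$S_\tau=K[\{x_i:\ 1\le i\le r,\ x_i\notin \textstyle\sum_{j\in\tau}P_j\}].$$ Let $\mathcal F$ be the set of all nonempty subsets $\tau\subset[s]$ such that $$L_\tau=\Big(\bigcap_{i\in\tau}P_i\Big)\cap S'\neq(0)\quad\text{and}\quad J_\tau=\Big(\bigcap_{i\in[s]\setminus\tau}P_i\Big)\cap S_\tau\neq(0).$$ Put $I_0=(I\cap K[x_1,\ldots,x_r])S$, and for $\tau\in\mathcal F$ let $$I_\tau=J_\tau S_\tau[x_{r+1},\ldots,x_n]\cap L_\tau S_\tau[x_{r+1},\ldots,x_n]\subset S_\tau[x_{r+1},\ldots,x_n].$$ Set $A_\tau=\operatorname{sdepth}_{S_\tau[x_{r+1},\ldots,x_n]}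 I_\tau$ for $\tau\in\mathcal F$; set $A_0=\operatorname{sdepth}_S I_0$ if $I_0\ne(0)$ and $A_0=n$ if $I_0=(0)$. Stanley depth: let $R=K[X]$ be a polynomial ring in a finite set $X$ of variables and $J\subset R$ a nonzero monomial ideal. For a monomial $u\in J$ and $Z\subset X$, $uK[Z]$ is the $K$-linear subspace generated by all $uf$, $f\in K[Z]$. A Stanley decomposition of $J$ is a presentation $\mathcal D:\ J=\bigoplus_{i=1}^m u_iK[Z_i]$ as a finite direct sum of $K$-subspaces, with $u_i\in J$ monomials and $Z_i\subset X$. Set $\operatorname{sdepth}(\mathcal D)=\min_i|Z_i|$, and let $\operatorname{sdepth}_R J$ be the maximum of $\operatorname{sdepth}(\mathcal D)$ over all Stanley decompositions $\mathcal D$ of $J$. *)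

theory Defs
  imports Complex_Main "HOL-Library.Poly_Mapping" "HOL-Library.Set_Algebras" "HOL-Algebra.Ideal"
begin

text \<open>
  Polynomials over the field \<open>'k\<close> in the variables \<open>x\<^sub>1, x\<^sub>2, \<dots>\<close> are finitely supported
  maps from exponent vectors to coefficients, with the convolution product of
  \<^theory>\<open>HOL-Library.Poly_Mapping\<close>. For a set \<open>X\<close> of indices, \<open>K[X]\<close> is the subring of the
  polynomials that involve only variables with index in \<open>X\<close>; thus \<open>S = K[{1..n}]\<close>,
  \<open>S' = K[{r+1..n}]\<close>, and all the rings in play are subrings of one another literally,
  without embeddings.
\<close>

type_synonym 'k mpoly = "(nat \<Rightarrow>\<^sub>0 nat) \<Rightarrow>\<^sub>0 'k"

definition Monom :: "(nat \<Rightarrow>\<^sub>0 nat) \<Rightarrow> 'k::field mpoly" where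
  "Monom u = Poly_Mapping.single u 1"

definition Var :: "nat \<Rightarrow> 'k::field mpoly" where
  "Var i = Monom (Poly_Mapping.single i 1)"

definition polys :: "nat set \<Rightarrow> 'k::field mpoly set" where
  "polys X = {p. \<forall>u \<in> Poly_Mapping.keys p. Poly_Mapping.keys u \<subseteq> X}"

definition poly_ring :: "nat set \<Rightarrow> 'k::field mpoly ring" where
  "poly_ring X = \<lparr>carrier = polys X, mult = (*), one = 1, zero = 0, add = (+)\<rparr>"

definition scale :: "'k::field \<Rightarrow> 'k mpoly \<Rightarrow> 'k mpoly" where
  "scale c p = Poly_Mapping.single 0 c * p"

interpretation mpoly: vector_space "scale :: 'k::field \<Rightarrow> 'k mpoly \<Rightarrow> 'k mpoly"
  by unfold_locales
    (simp_all add: scale_def algebra_simps single_add mult_single flip: mult.assoc)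

lemma polys_zero: "0 \<in> polys X" and polys_one: "1 \<in> polys X"
  by (simp_all add: polys_def)

lemma polys_add: "p + q \<in> polys X" if "p \<in> polys X" "q \<in> polys X"
  using that Poly_Mapping.keys_add[of p q] by (auto simp: polys_def)

lemma polys_uminus: "- p \<in> polys X" if "p \<in> polys X"
  using that by (simp add: polys_def in_keys_iff)

lemma polys_mult: "p * q \<in> polys X" if "p \<in> polys X" "q \<in> polys X"
proof -
  have "Poly_Mapping.keys w \<subseteq> X" if w: "w \<in> Poly_Mapping.keys (p * q)" for w
  proof -
    obtain u v where "w = u + v" "u \<in> Poly_Mapping.keys p" "v \<in> Poly_Mapping.keys q"
      using w keys_mult[of p q] by auto
    then show ?thesis
      using \<open>p \<in> polys X\<close> \<open>q \<in> polys X\<close> Poly_Mapping.keys_add[of u v]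
      by (fastforce simp: polys_def)
  qed
  then show ?thesis by (simp add: polys_def)
qed

lemma cring_poly_ring: "cring (poly_ring X)"
proof (rule cringI)
  show "abelian_group (poly_ring X)"
    by (rule abelian_groupI)
      (auto simp: poly_ring_def polys_zero polys_add algebra_simps
        intro!: bexI[OF _ polys_uminus])
  show "Group.comm_monoid (poly_ring X)"
    by (rule comm_monoidI) (auto simp: poly_ring_def polys_one polys_mult algebra_simps)
qed (simp add: poly_ring_def algebra_simps)

definition monomial_prime :: "nat set \<Rightarrow> 'k::field mpoly set \<Rightarrow> bool" where
  "monomial_prime X Q \<longleftrightarrow> (\<exists>A \<subseteq> X. Q = Idl\<^bsub>poly_ring X\<^esub> (Var ` A))"

definition irredundant :: "nat \<Rightarrow> (nat \<Rightarrow> 'k::field mpoly set) \<Rightarrow> bool" where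
  "irredundant s P \<longleftrightarrow>
     (\<forall>j \<in> {1..s}. (\<Inter>i \<in> {1..s} - {j}. P i) \<noteq> (\<Inter>i \<in> {1..s}. P i))"


subsection \<open>Stanley depth\<close>

text \<open>\<open>W\<close> is the internal direct sum of the \<open>V i\<close>: every element of \<open>W\<close> is the sum of
  exactly one family with \<open>v i \<in> V i\<close>, and all such sums lie in \<open>W\<close>.\<close>

definition is_direct_sum :: "'i set \<Rightarrow> ('i \<Rightarrow> 'v::comm_monoid_add set) \<Rightarrow> 'v set \<Rightarrow> bool" where
  "is_direct_sum I V W \<longleftrightarrow> finite I \<and> bij_betw (\<lambda>v. \<Sum>i\<in>I. v i) (\<Pi>\<^sub>E i\<in>I. V i) W"

definition Stanley_space :: "(nat \<Rightarrow>\<^sub>0 nat) \<Rightarrow> nat set \<Rightarrow> 'k::field mpoly set" where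
  "Stanley_space u Z = mpoly.span {Monom u * f | f. f \<in> polys Z}"

text \<open>A decomposition is the list of its pairs \<open>(u\<^sub>i, Z\<^sub>i)\<close>, the monomial \<open>u\<^sub>i\<close> being given by
  its exponent vector.\<close>

definition Stanley_decomposition ::
    "nat set \<Rightarrow> 'k::field mpoly set \<Rightarrow> ((nat \<Rightarrow>\<^sub>0 nat) \<times> nat set) list \<Rightarrow> bool" where
  "Stanley_decomposition X J D \<longleftrightarrow>
     (\<forall>(u, Z) \<in> set D. Monom u \<in> J \<and> Z \<subseteq> X) \<and>
     is_direct_sum {..<length D} (\<lambda>i. Stanley_space (fst (D ! i)) (snd (D ! i))) J"

definition decomposition_sdepth :: "((nat \<Rightarrow>\<^sub>0 nat) \<times> nat set) list \<Rightarrow> nat" where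
  "decomposition_sdepth D = Min ((\<lambda>(u, Z). card Z) ` set D)"

text \<open>Meaningful for finite \<open>X\<close> and a nonzero monomial ideal \<open>J\<close> of \<open>K[X]\<close>: then every
  decomposition is nonempty and the set below is bounded by \<open>card X\<close>.\<close>

definition sdepth :: "nat set \<Rightarrow> 'k::field mpoly set \<Rightarrow> nat" where
  "sdepth X J = Max {decomposition_sdepth D | D. Stanley_decomposition X J D}"


subsection \<open>The ideals attached to \<open>P\<^sub>1, \<dots>, P\<^sub>s\<close> and \<open>r\<close>\<close>

text \<open>The indices of the variables of \<open>S\<^sub>\<tau>\<close>. The sum of the ideals is the elementwise sum
  from \<^theory>\<open>HOL-Library.Set_Algebras\<close>.\<close>

definition S_vars :: "nat \<Rightarrow> (nat \<Rightarrow> 'k::field mpoly set) \<Rightarrow> nat set \<Rightarrow> nat set" where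
  "S_vars r P \<tau> = {i \<in> {1..r}. Var i \<notin> (\<Sum>j\<in>\<tau>. P j)}"

definition L_ideal :: "nat \<Rightarrow> nat \<Rightarrow> (nat \<Rightarrow> 'k::field mpoly set) \<Rightarrow> nat set \<Rightarrow> 'k mpoly set" where
  "L_ideal n r P \<tau> = (\<Inter>i\<in>\<tau>. P i) \<inter> polys {r+1..n}"

text \<open>For \<open>\<tau> = [s]\<close> the empty intersection contributes nothing, so that \<open>J\<^sub>\<tau> = S\<^sub>\<tau>\<close>.\<close>

definition J_ideal :: "nat \<Rightarrow> nat \<Rightarrow> (nat \<Rightarrow> 'k::field mpoly set) \<Rightarrow> nat set \<Rightarrow> 'k mpoly set" where
  "J_ideal r s P \<tau> = (\<Inter>i \<in> {1..s} - \<tau>. P i) \<inter> polys (S_vars r P \<tau>)"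

definition F_family :: "nat \<Rightarrow> nat \<Rightarrow> nat \<Rightarrow> (nat \<Rightarrow> 'k::field mpoly set) \<Rightarrow> nat set set" where
  "F_family n r s P =
     {\<tau>. \<tau> \<subseteq> {1..s} \<and> \<tau> \<noteq> {} \<and> L_ideal n r P \<tau> \<noteq> {0} \<and> J_ideal r s P \<tau> \<noteq> {0}}"

definition I_zero :: "nat \<Rightarrow> nat \<Rightarrow> 'k::field mpoly set \<Rightarrow> 'k mpoly set" where
  "I_zero n r I = Idl\<^bsub>poly_ring {1..n}\<^esub> (I \<inter> polys {1..r})"

definition I_tau ::
    "nat \<Rightarrow> nat \<Rightarrow> nat \<Rightarrow> (nat \<Rightarrow> 'k::field mpoly set) \<Rightarrow> nat set \<Rightarrow> 'k mpoly set" where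
  "I_tau n r s P \<tau> =
     Idl\<^bsub>poly_ring (S_vars r P \<tau> \<union> {r+1..n})\<^esub> (J_ideal r s P \<tau>) \<inter>
     Idl\<^bsub>poly_ring (S_vars r P \<tau> \<union> {r+1..n})\<^esub> (L_ideal n r P \<tau>)"

definition A_zero :: "nat \<Rightarrow> nat \<Rightarrow> 'k::field mpoly set \<Rightarrow> nat" where
  "A_zero n r I = (if I_zero n r I \<noteq> {0} then sdepth {1..n} (I_zero n r I) else n)"

definition A_tau :: "nat \<Rightarrow> nat \<Rightarrow> nat \<Rightarrow> (nat \<Rightarrow> 'k::field mpoly set) \<Rightarrow> nat set \<Rightarrow> nat" where
  "A_tau n r s P \<tau> = sdepth (S_vars r P \<tau> \<union> {r+1..n}) (I_tau n r s P \<tau>)"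

end

theory Submission
  imports Defs "HOL-Library.Disjoint_Sets"
begin

text \<open>
  Write \<open>P\<^sub>i\<close> as the ideal generated by the variables with index in a set \<open>A\<^sub>i\<close>. A monomial lies in
  \<open>I\<close> iff its support meets every \<open>A\<^sub>i\<close>. Factor it as \<open>v w\<close> with \<open>v\<close> in the first \<open>r\<close> variables and
  \<open>w\<close> in the others, and let \<open>\<tau>\<close> be the set of those \<open>i\<close> for which \<open>v\<close> misses \<open>A\<^sub>i\<close>. This partitions
  the monomials of \<open>I\<close> into strata. The stratum of \<open>\<tau> = \<emptyset>\<close> consists of the monomials of \<open>I\<^sub>0\<close>. For
  \<open>\<tau> \<noteq> \<emptyset>\<close>, membership in the stratum says that \<open>v\<close> avoids all \<open>A\<^sub>i\<close> with \<open>i \<in> \<tau>\<close>, so that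
  \<open>v \<in> S\<^sub>\<tau>\<close>, that \<open>v\<close> meets the remaining \<open>A\<^sub>i\<close>, so that \<open>v \<in> J\<^sub>\<tau>\<close>, and that \<open>w\<close> has to meet the
  \<open>A\<^sub>i\<close> missed by \<open>v\<close>, so that \<open>w \<in> L\<^sub>\<tau>\<close>: these are the monomials of \<open>I\<^sub>\<tau>\<close>. A nonempty stratum
  with \<open>\<tau> \<noteq> \<emptyset>\<close> has its index in \<open>\<F>\<close>. Hence
  \<open>I = I\<^sub>0 \<oplus> (\<Oplus>\<tau>\<in>\<F>. I\<^sub>\<tau>)\<close>, and optimal Stanley decompositions of the nonzero summands
  together form one of \<open>I\<close>, whose Stanley depth is the least of those used.

  All ideals involved are squarefree: which monomials they contain depends on the supports alone.
  They are therefore written as \<open>sq_span \<G>\<close> for a family \<open>\<G>\<close> of sets of variables, and the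
  identification of the summands (lemmas \<open>I_zero_eq\<close>, \<open>I_tau_eq\<close>) becomes a statement about finite
  sets (\<open>stratum_split_iff\<close>). Likewise, a list of pairs \<open>(u, Z)\<close> is a Stanley decomposition iff
  every exponent vector of the ideal lies in exactly one of the cones \<open>u + \<nat>\<^sup>Z\<close> and no other
  vector lies in any (\<open>Stanley_decomposition_mono_span_iff\<close>); in this form decompositions of
  disjoint pieces can simply be concatenated.

  Since the Stanley depth is the maximum of a set of numbers, its value says something
  only if this set is finite and nonempty. It is bounded by the number of variables
  (\<open>finite_decomposition_sdepths\<close>), and each squarefree ideal has the decomposition into the spaces
  \<open>x\<^sub>F K[F]\<close>, where \<open>x\<^sub>F\<close> is the product of the variables in \<open>F\<close> and \<open>F\<close> runs through the supports
  that occur (\<open>Stanley_decomposition_sq_span_exists\<close>).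
\<close>

section \<open>Spaces spanned by monomials\<close>

abbreviation supp :: "(nat \<Rightarrow>\<^sub>0 nat) \<Rightarrow> nat set" where
  "supp \<equiv> Poly_Mapping.keys"

definition mono_span :: "(nat \<Rightarrow>\<^sub>0 nat) set \<Rightarrow> 'k::field mpoly set" where
  "mono_span M = {p. Poly_Mapping.keys p \<subseteq> M}"

lemma supp_add: "supp (u + v) = supp u \<union> supp v"
  by (auto simp: in_keys_iff lookup_add)

lemma mono_span_zero: "0 \<in> mono_span M"
  by (simp add: mono_span_def)

lemma mono_span_add: "p \<in> mono_span M \<Longrightarrow> q \<in> mono_span M \<Longrightarrow> p + q \<in> mono_span M"
  using Poly_Mapping.keys_add[of p q] by (auto simp: mono_span_def)

lemma mono_span_mult:
  assumes "p \<in> mono_span M" "q \<in> mono_span N"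
    and "\<And>u v. u \<in> M \<Longrightarrow> v \<in> N \<Longrightarrow> u + v \<in> L"
  shows "p * q \<in> mono_span L"
  using assms keys_mult[of p q] by (fastforce simp: mono_span_def)

lemma single_in_mono_span: "w \<in> M \<Longrightarrow> Poly_Mapping.single w c \<in> mono_span M"
  by (simp add: mono_span_def)

lemma Monom_in_mono_span_iff: "(Monom w :: 'k::field mpoly) \<in> mono_span M \<longleftrightarrow> w \<in> M"
  by (simp add: mono_span_def Monom_def)

lemma Monom_nonzero: "Monom w \<noteq> 0"
  by (metis Monom_def keys_eq_empty keys_single insert_not_empty zero_neq_one)

lemma polys_eq_mono_span: "polys X = mono_span {u. supp u \<subseteq> X}"
  by (auto simp: polys_def mono_span_def)

lemma mono_span_induct [consumes 1, case_names zero add single]: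
  assumes "p \<in> mono_span M"
    and "Q 0"
    and add: "\<And>p q. Q p \<Longrightarrow> Q q \<Longrightarrow> Q (p + q)"
    and single: "\<And>w c. w \<in> M \<Longrightarrow> Q (Poly_Mapping.single w c)"
  shows "Q p"
proof -
  have "Q (\<Sum>w\<in>B. Poly_Mapping.single w (Poly_Mapping.lookup p w))" if "finite B" "B \<subseteq> M" for B
    using that by (induction B rule: finite_induct) (auto simp: assms)
  moreover have "p = (\<Sum>w\<in>Poly_Mapping.keys p. Poly_Mapping.single w (Poly_Mapping.lookup p w))"
    by (rule poly_mapping_eqI) (auto simp: lookup_sum lookup_single when_def in_keys_iff)
  ultimately show ?thesis
    using assms(1) by (metis finite_keys mem_Collect_eq mono_span_def)
qed

definition pm_restrict :: "'a set \<Rightarrow> ('a \<Rightarrow>\<^sub>0 'b::zero) \<Rightarrow> 'a \<Rightarrow>\<^sub>0 'b" where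
  "pm_restrict B p = Abs_poly_mapping (\<lambda>k. if k \<in> B then Poly_Mapping.lookup p k else 0)"

lemma lookup_pm_restrict:
  "Poly_Mapping.lookup (pm_restrict B p) k = (if k \<in> B then Poly_Mapping.lookup p k else 0)"
proof -
  have "finite {k. (if k \<in> B then Poly_Mapping.lookup p k else 0) \<noteq> 0}"
    by (rule finite_subset[OF _ finite_keys[of p]]) (simp add: in_keys_iff subset_iff)
  then show ?thesis by (simp add: pm_restrict_def)
qed

lemma keys_pm_restrict: "Poly_Mapping.keys (pm_restrict B p) = Poly_Mapping.keys p \<inter> B"
  by (auto simp: in_keys_iff lookup_pm_restrict split: if_splits)

lemma pm_restrict_add_compl: "pm_restrict B p + pm_restrict (- B) p = p"
  for p :: "'a \<Rightarrow>\<^sub>0 'b::monoid_add"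
  by (rule poly_mapping_eqI) (simp add: lookup_add lookup_pm_restrict)

text \<open>
  A space spanned by monomials is a direct sum of such spaces iff the monomials are partitioned. A
  monomial that lies in two of the summands would have two representations; conversely, the
  component of a polynomial in the \<open>i\<close>-th summand must be its restriction to \<open>M i\<close>. Counting the
  summands that contain \<open>w\<close> expresses disjointness and covering by a single additive equation.
\<close>

lemma is_direct_sum_mono_span_iff:
  fixes M :: "'i \<Rightarrow> (nat \<Rightarrow>\<^sub>0 nat) set"
  assumes fin: "finite I"
  shows "is_direct_sum I (\<lambda>i. mono_span (M i) :: 'k::field mpoly set) (mono_span W) \<longleftrightarrow>
    (\<forall>w. card {i \<in> I. w \<in> M i} = of_bool (w \<in> W))"
    (is "?direct \<longleftrightarrow> ?count")
proof
  let ?V = "\<Pi>\<^sub>E i\<in>I. (mono_span (M i) :: 'k mpoly set)"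
  assume ?direct
  then have inj: "inj_on (\<lambda>v. \<Sum>i\<in>I. v i) ?V" and img: "(\<lambda>v. \<Sum>i\<in>I. v i) ` ?V = mono_span W"
    by (auto simp: is_direct_sum_def bij_betw_def)
  \<comment> \<open>the representation of the monomial \<open>w\<close> that uses the \<open>i\<close>-th summand only\<close>
  define e where "e w i = (\<lambda>j\<in>I. if j = i then Monom w else 0 :: 'k mpoly)" for w i
  have e_in: "e w i \<in> ?V" and e_sum: "(\<Sum>j\<in>I. e w i j) = Monom w" if "i \<in> I" "w \<in> M i" for w i
    using that fin by (auto simp: e_def mono_span_zero Monom_in_mono_span_iff)
  show ?count
  proof
    fix w
    show "card {i \<in> I. w \<in> M i} = of_bool (w \<in> W)"
    proof (cases "w \<in> W")
      case True
      then have "(Monom w :: 'k mpoly) \<in> mono_span W" by (simp add: Monom_in_mono_span_iff)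
      then obtain v where v: "v \<in> ?V" "(Monom w :: 'k mpoly) = (\<Sum>i\<in>I. v i)"
        using img by (metis (no_types, lifting) imageE)
      have "w \<in> Poly_Mapping.keys (Monom w :: 'k mpoly)" by (simp add: Monom_def)
      then obtain i where i: "i \<in> I" "w \<in> M i"
        using keys_sum[of v I] v by (fastforce simp: mono_span_def PiE_iff)
      have "j = i" if "j \<in> I" "w \<in> M j" for j
      proof (rule ccontr)
        assume "j \<noteq> i"
        have "e w i = e w j"
          using inj e_in[OF i] e_in[OF that] e_sum[OF i] e_sum[OF that] by (metis (no_types, lifting) inj_onD)
        then have "e w i i = e w j i" by simp
        with i \<open>j \<noteq> i\<close> show False by (simp add: e_def Monom_nonzero split: if_splits)
      qed
      with i have one: "{i \<in> I. w \<in> M i} = {i}" by blast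
      show ?thesis unfolding one using True by simp
    next
      case False
      have "w \<in> W" if "i \<in> I" "w \<in> M i" for i
      proof -
        have "(\<Sum>j\<in>I. e w i j) \<in> mono_span W" using e_in[OF that] img by blast
        then show ?thesis using e_sum[OF that] by (simp add: Monom_in_mono_span_iff)
      qed
      with False have none: "{i \<in> I. w \<in> M i} = {}" by blast
      show ?thesis unfolding none using False by simp
    qed
  qed
next
  let ?V = "\<Pi>\<^sub>E i\<in>I. (mono_span (M i) :: 'k mpoly set)"
  assume count: ?count
  have uniq: "i = j" if "i \<in> I" "j \<in> I" "w \<in> M i" "w \<in> M j" for i j w
  proof -
    have "card {i \<in> I. w \<in> M i} \<le> Suc 0" using count by simp
    then show ?thesis using that fin by (auto simp: card_le_Suc0_iff_eq)
  qed
  have cover: "w \<in> W" if "i \<in> I" "w \<in> M i" for i w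
  proof (rule ccontr)
    assume "w \<notin> W"
    with count have "card {i \<in> I. w \<in> M i} = 0" by simp
    with fin that show False by auto
  qed
  have "bij_betw (\<lambda>v. \<Sum>i\<in>I. v i) ?V (mono_span W)"
  proof (rule bij_betw_byWitness[where f' = "\<lambda>p. \<lambda>i\<in>I. pm_restrict (M i) p"])
    show "\<forall>v\<in>?V. (\<lambda>i\<in>I. pm_restrict (M i) (\<Sum>i\<in>I. v i)) = v"
    proof
      fix v assume v: "v \<in> ?V"
      have zero: "Poly_Mapping.lookup (v j) w = 0" if "j \<in> I" "w \<notin> M j" for j w
      proof -
        have "Poly_Mapping.keys (v j) \<subseteq> M j" using v that by (auto simp: mono_span_def PiE_iff)
        then show ?thesis using that(2) by (auto simp: in_keys_iff)
      qed
      have "pm_restrict (M i) (\<Sum>i\<in>I. v i) = v i" if i: "i \<in> I" for i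
      proof (rule poly_mapping_eqI)
        fix w
        show "Poly_Mapping.lookup (pm_restrict (M i) (\<Sum>i\<in>I. v i)) w = Poly_Mapping.lookup (v i) w"
        proof (cases "w \<in> M i")
          case True
          have "(\<Sum>j\<in>I. Poly_Mapping.lookup (v j) w) = (\<Sum>j\<in>{i}. Poly_Mapping.lookup (v j) w)"
            using i True uniq zero fin by (intro sum.mono_neutral_right) blast+
          with True show ?thesis by (simp add: lookup_pm_restrict lookup_sum)
        qed (simp add: lookup_pm_restrict zero i)
      qed
      with v show "(\<lambda>i\<in>I. pm_restrict (M i) (\<Sum>i\<in>I. v i)) = v"
        by (intro PiE_ext[of _ I "\<lambda>i. mono_span (M i)"]) (auto simp: PiE_iff)
    qed
    show "\<forall>p\<in>mono_span W. (\<Sum>i\<in>I. (\<lambda>i\<in>I. pm_restrict (M i) p) i) = (p :: 'k mpoly)"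
    proof
      fix p :: "'k mpoly" assume p: "p \<in> mono_span W"
      show "(\<Sum>i\<in>I. (\<lambda>i\<in>I. pm_restrict (M i) p) i) = p"
      proof (rule poly_mapping_eqI)
        fix w
        have "Poly_Mapping.lookup (\<Sum>i\<in>I. (\<lambda>i\<in>I. pm_restrict (M i) p) i) w
            = (\<Sum>i\<in>I. if w \<in> M i then Poly_Mapping.lookup p w else 0)"
          by (simp add: lookup_sum lookup_pm_restrict)
        also have "\<dots> = of_nat (card {i \<in> I. w \<in> M i}) * Poly_Mapping.lookup p w"
          using fin by (simp add: sum.inter_filter[symmetric])
        also have "\<dots> = Poly_Mapping.lookup p w"
          using p count by (auto simp: mono_span_def in_keys_iff)
        finally show "Poly_Mapping.lookup (\<Sum>i\<in>I. (\<lambda>i\<in>I. pm_restrict (M i) p) i) w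
            = Poly_Mapping.lookup p w" .
      qed
    qed
    show "(\<lambda>v. \<Sum>i\<in>I. v i) ` ?V \<subseteq> mono_span W"
    proof (rule image_subsetI)
      fix v assume "v \<in> ?V"
      then show "(\<Sum>i\<in>I. v i) \<in> mono_span W"
        using keys_sum[of v I] cover by (fastforce simp: mono_span_def PiE_iff)
    qed
    show "(\<lambda>p. \<lambda>i\<in>I. pm_restrict (M i) p) ` mono_span W \<subseteq> ?V"
      by (auto simp: mono_span_def keys_pm_restrict)
  qed
  with fin show ?direct by (simp add: is_direct_sum_def)
qed


section \<open>Monomial ideals\<close>

lemma a_inv_poly_ring:
  assumes "p \<in> polys X"
  shows "\<ominus>\<^bsub>poly_ring X\<^esub> p = - p"
proof -
  interpret cring "poly_ring X :: 'a mpoly ring" by (rule cring_poly_ring)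
  show ?thesis
    using assms by (intro minus_equality) (auto simp: poly_ring_def polys_uminus)
qed

lemma mono_span_uminus: "p \<in> mono_span M \<Longrightarrow> - p \<in> mono_span M"
  by (simp add: mono_span_def in_keys_iff subset_iff)

lemma ideal_mono_span:
  assumes "N \<subseteq> {w. supp w \<subseteq> X}" "\<And>u v. u \<in> N \<Longrightarrow> supp v \<subseteq> X \<Longrightarrow> v + u \<in> N"
  shows "ideal (mono_span N) (poly_ring X :: 'k::field mpoly ring)"
proof -
  interpret cring "poly_ring X :: 'k mpoly ring" by (rule cring_poly_ring)
  have sub: "mono_span N \<subseteq> (polys X :: 'k mpoly set)"
    using assms(1) by (auto simp: polys_eq_mono_span mono_span_def)
  have mult: "q * p \<in> mono_span N" if "p \<in> mono_span N" "q \<in> polys X" for p q :: "'k mpoly"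
    using that assms(2) unfolding polys_eq_mono_span by (auto intro: mono_span_mult[of q _ p N])
  show ?thesis
  proof (rule idealI)
    show "ring (poly_ring X :: 'k mpoly ring)" by (rule ring_axioms)
    show "subgroup (mono_span N) (add_monoid (poly_ring X :: 'k mpoly ring))"
    proof
      show "inv\<^bsub>add_monoid (poly_ring X)\<^esub> p \<in> mono_span N" if "p \<in> mono_span N" for p :: "'k mpoly"
        using a_inv_poly_ring[of p X] that sub by (auto simp: a_inv_def mono_span_uminus)
    qed (use sub in \<open>auto simp: poly_ring_def mono_span_zero mono_span_add\<close>)
  qed (use mult in \<open>auto simp: poly_ring_def mult.commute\<close>)
qed

text \<open>
  The two bounds on \<open>G\<close> let one statement serve both kinds of generating sets that occur: a set of
  monomials, and a space spanned by monomials.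
\<close>

lemma genideal_monomials:
  fixes G :: "'k::field mpoly set"
  assumes M: "M \<subseteq> {u. supp u \<subseteq> X}" and G: "Monom ` M \<subseteq> G" "G \<subseteq> mono_span M"
  shows "Idl\<^bsub>poly_ring X\<^esub> G = mono_span {u + v | u v. u \<in> M \<and> supp v \<subseteq> X}" (is "_ = mono_span ?N")
proof
  interpret cring "poly_ring X :: 'k mpoly ring" by (rule cring_poly_ring)
  have ideal: "ideal (mono_span ?N :: 'k mpoly set) (poly_ring X)"
  proof (rule ideal_mono_span)
    show "?N \<subseteq> {w. supp w \<subseteq> X}" using M by (fastforce simp: supp_add)
    show "v + w \<in> ?N" if w: "w \<in> ?N" and v: "supp v \<subseteq> X" for w v
    proof -
      obtain a b where "w = a + b" "a \<in> M" "supp b \<subseteq> X" using w by blast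
      with v have "v + w = a + (b + v)" "supp (b + v) \<subseteq> X" by (auto simp: supp_add algebra_simps)
      with \<open>a \<in> M\<close> show ?thesis by blast
    qed
  qed
  have "M \<subseteq> ?N" by (force intro: exI[of _ 0])
  with G have "G \<subseteq> mono_span ?N" unfolding mono_span_def by blast
  with ideal show "Idl\<^bsub>poly_ring X\<^esub> G \<subseteq> mono_span ?N" by (rule genideal_minimal)
  have G_carrier: "G \<subseteq> carrier (poly_ring X)"
    using G(2) M by (auto simp: poly_ring_def polys_def mono_span_def)
  interpret J: ideal "Idl\<^bsub>poly_ring X\<^esub> G" "poly_ring X" by (rule genideal_ideal[OF G_carrier])
  show "mono_span ?N \<subseteq> Idl\<^bsub>poly_ring X\<^esub> G"
  proof
    fix p :: "'k mpoly" assume "p \<in> mono_span ?N"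
    then show "p \<in> Idl\<^bsub>poly_ring X\<^esub> G"
    proof (induction rule: mono_span_induct)
      case zero
      show ?case using J.zero_closed by (simp add: poly_ring_def)
    next
      case (add p q)
      then show ?case using J.a_closed[of p q] by (simp add: poly_ring_def)
    next
      case (single w c)
      then obtain u v where w: "w = u + v" "u \<in> M" "supp v \<subseteq> X" by blast
      have "Monom u \<in> Idl\<^bsub>poly_ring X\<^esub> G" using genideal_self[OF G_carrier] G(1) w by blast
      moreover have "Poly_Mapping.single v c \<in> carrier (poly_ring X)"
        using w by (auto simp: poly_ring_def polys_def)
      ultimately have "Poly_Mapping.single v c \<otimes>\<^bsub>poly_ring X\<^esub> Monom u \<in> Idl\<^bsub>poly_ring X\<^esub> G"
        by (rule J.I_l_closed)
      then show ?case by (simp add: poly_ring_def Monom_def mult_single w add.commute)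
    qed
  qed
qed


section \<open>Squarefree monomial spaces\<close>

text \<open>
  Squarefree ideals have this form: a monomial belongs to such an ideal iff the squarefree monomial
  with the same support does, so that the family of supports determines the ideal.
\<close>

definition sq_span :: "nat set set \<Rightarrow> 'k::field mpoly set" where
  "sq_span \<F> = mono_span {u. supp u \<in> \<F>}"

lemma mem_sq_span_iff: "p \<in> sq_span \<F> \<longleftrightarrow> (\<forall>u\<in>Poly_Mapping.keys p. supp u \<in> \<F>)"
  by (auto simp: sq_span_def mono_span_def)

lemma polys_eq_sq_span: "polys X = sq_span (Pow X)"
  unfolding polys_def sq_span_def mono_span_def by blast

definition sq_exp :: "nat set \<Rightarrow> nat \<Rightarrow>\<^sub>0 nat" where
  "sq_exp F = (\<Sum>i\<in>F. Poly_Mapping.single i 1)"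

lemma lookup_sq_exp: "finite F \<Longrightarrow> Poly_Mapping.lookup (sq_exp F) i = of_bool (i \<in> F)"
  by (simp add: sq_exp_def lookup_sum lookup_single when_def)

lemma supp_sq_exp: "finite F \<Longrightarrow> supp (sq_exp F) = F"
  by (auto simp: in_keys_iff lookup_sq_exp)

lemma sq_span_nonzero:
  assumes "F \<in> \<F>" "finite F"
  shows "(sq_span \<F> :: 'k::field mpoly set) \<noteq> {0}"
proof -
  have "(Monom (sq_exp F) :: 'k mpoly) \<in> sq_span \<F>"
    using assms by (simp add: sq_span_def Monom_in_mono_span_iff supp_sq_exp)
  then show ?thesis using Monom_nonzero by blast
qed

lemma sq_span_empty: "sq_span {} = {0}"
  by (auto simp: sq_span_def mono_span_def)

text \<open>
  Extending a squarefree ideal of \<open>K[Y]\<close> to \<open>K[X]\<close>: a monomial \<open>w\<close> lies in the extension iff its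
  \<open>Y\<close>-part does, since \<open>w\<close> is the product of its \<open>Y\<close>-part and a monomial in the other variables.
  Upward closure in \<open>Pow Y\<close> says that \<open>sq_span \<F>\<close> is an ideal of \<open>K[Y]\<close>.
\<close>

lemma genideal_sq_span:
  assumes "Y \<subseteq> X" "\<F> \<subseteq> Pow Y" and up: "\<And>F G. F \<in> \<F> \<Longrightarrow> F \<subseteq> G \<Longrightarrow> G \<subseteq> Y \<Longrightarrow> G \<in> \<F>"
  shows "Idl\<^bsub>poly_ring X\<^esub> (sq_span \<F> :: 'k::field mpoly set) = sq_span {F. F \<subseteq> X \<and> F \<inter> Y \<in> \<F>}"
proof -
  let ?M = "{u. supp u \<in> \<F>}"
  have "Idl\<^bsub>poly_ring X\<^esub> (sq_span \<F> :: 'k mpoly set)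
      = mono_span {u + v | u v. u \<in> ?M \<and> supp v \<subseteq> X}"
    using assms(1,2) by (intro genideal_monomials) (auto simp: sq_span_def Monom_in_mono_span_iff)
  also have "{u + v | u v. u \<in> ?M \<and> supp v \<subseteq> X} = {w. supp w \<subseteq> X \<and> supp w \<inter> Y \<in> \<F>}"
  proof (intro equalityI subsetI)
    fix w assume "w \<in> {u + v | u v. u \<in> ?M \<and> supp v \<subseteq> X}"
    then obtain u v where w: "w = u + v" "supp u \<in> \<F>" "supp v \<subseteq> X" by blast
    moreover have "supp u \<subseteq> Y" using w(2) assms(2) by blast
    ultimately show "w \<in> {w. supp w \<subseteq> X \<and> supp w \<inter> Y \<in> \<F>}"
      using assms(1) up[OF w(2), of "supp w \<inter> Y"] by (auto simp: supp_add)
  next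
    fix w assume "w \<in> {w. supp w \<subseteq> X \<and> supp w \<inter> Y \<in> \<F>}"
    then have "pm_restrict Y w \<in> ?M" "supp (pm_restrict (- Y) w) \<subseteq> X"
      by (auto simp: keys_pm_restrict)
    then show "w \<in> {u + v | u v. u \<in> ?M \<and> supp v \<subseteq> X}"
      using pm_restrict_add_compl[of Y w, symmetric] by blast
  qed
  finally show ?thesis by (simp add: sq_span_def)
qed

lemma genideal_Var:
  assumes "A \<subseteq> X"
  shows "Idl\<^bsub>poly_ring X\<^esub> (Var ` A :: 'k::field mpoly set) = sq_span {F. F \<subseteq> X \<and> F \<inter> A \<noteq> {}}"
proof -
  let ?M = "(\<lambda>i. Poly_Mapping.single i (1::nat)) ` A"
  have "Idl\<^bsub>poly_ring X\<^esub> (Var ` A :: 'k mpoly set)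
      = mono_span {u + v | u v. u \<in> ?M \<and> supp v \<subseteq> X}"
    using assms by (intro genideal_monomials) (auto simp: Var_def Monom_in_mono_span_iff)
  also have "{u + v | u v. u \<in> ?M \<and> supp v \<subseteq> X} = {w. supp w \<subseteq> X \<and> supp w \<inter> A \<noteq> {}}"
  proof (intro equalityI subsetI)
    fix w assume "w \<in> {u + v | u v. u \<in> ?M \<and> supp v \<subseteq> X}"
    then show "w \<in> {w. supp w \<subseteq> X \<and> supp w \<inter> A \<noteq> {}}"
      using assms by (auto simp: supp_add)
  next
    fix w assume w: "w \<in> {w. supp w \<subseteq> X \<and> supp w \<inter> A \<noteq> {}}"
    then obtain i where i: "i \<in> supp w" "i \<in> A" by blast
    let ?v = "w - Poly_Mapping.single i 1"
    have "w = Poly_Mapping.single i 1 + ?v"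
      using i by (intro poly_mapping_eqI) (auto simp: lookup_add lookup_minus lookup_single when_def in_keys_iff)
    moreover have "supp ?v \<subseteq> supp w"
      by (auto simp: in_keys_iff lookup_minus)
    then have "supp ?v \<subseteq> X" using w by blast
    ultimately show "w \<in> {u + v | u v. u \<in> ?M \<and> supp v \<subseteq> X}" using i by blast
  qed
  finally show ?thesis by (simp add: sq_span_def)
qed


section \<open>Stanley decompositions of spaces spanned by monomials\<close>

text \<open>
  The exponent vectors of the monomials in the Stanley space of the pair.
\<close>

definition cone :: "(nat \<Rightarrow>\<^sub>0 nat) \<times> nat set \<Rightarrow> (nat \<Rightarrow>\<^sub>0 nat) set" where
  "cone d = {fst d + v | v. supp v \<subseteq> snd d}"

lemma Stanley_space_eq_mono_span: "(Stanley_space u Z :: 'k::field mpoly set) = mono_span (cone (u, Z))"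
proof
  have "Monom u * f \<in> mono_span (cone (u, Z))" if "f \<in> polys Z" for f :: "'k mpoly"
    using that unfolding polys_eq_mono_span
    by (rule mono_span_mult[of "Monom u" "{u}", rotated]) (auto simp: cone_def Monom_in_mono_span_iff)
  moreover have "mpoly.subspace (mono_span (cone (u, Z)) :: 'k mpoly set)"
  proof (rule mpoly.subspaceI)
    show "scale c p \<in> mono_span (cone (u, Z))" if "p \<in> mono_span (cone (u, Z))" for c and p :: "'k mpoly"
      unfolding scale_def
      by (rule mono_span_mult[OF single_in_mono_span[of 0 "{0}"] that]) auto
  qed (simp_all add: mono_span_zero mono_span_add)
  ultimately show "Stanley_space u Z \<subseteq> (mono_span (cone (u, Z)) :: 'k mpoly set)"
    unfolding Stanley_space_def by (intro mpoly.span_minimal) auto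
  show "mono_span (cone (u, Z)) \<subseteq> (Stanley_space u Z :: 'k mpoly set)"
  proof
    fix p :: "'k mpoly" assume "p \<in> mono_span (cone (u, Z))"
    then show "p \<in> Stanley_space u Z"
    proof (induction rule: mono_span_induct)
      case (single w c)
      then obtain v where v: "w = u + v" "supp v \<subseteq> Z" by (auto simp: cone_def)
      then have "Poly_Mapping.single w c = Monom u * Poly_Mapping.single v c"
        by (simp add: Monom_def mult_single)
      moreover have "Poly_Mapping.single v c \<in> polys Z" using v by (simp add: polys_def)
      ultimately show ?case unfolding Stanley_space_def by (blast intro: mpoly.span_base)
    qed (simp_all add: Stanley_space_def mpoly.span_zero mpoly.span_add)
  qed
qed

text \<open>
  The criterion by which all decompositions below are built: each \<open>w\<close> is counted exactly once if it
  belongs to \<open>W\<close> and not at all otherwise.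
\<close>

lemma Stanley_decomposition_mono_span_iff:
  "Stanley_decomposition X (mono_span W :: 'k::field mpoly set) D \<longleftrightarrow>
    (\<forall>(u, Z) \<in> set D. u \<in> W \<and> Z \<subseteq> X) \<and>
    (\<forall>w. length (filter (\<lambda>d. w \<in> cone d) D) = of_bool (w \<in> W))"
  by (simp add: Stanley_decomposition_def Monom_in_mono_span_iff Stanley_space_eq_mono_span
      is_direct_sum_mono_span_iff length_filter_conv_card)

text \<open>
  The number of cones containing a vector is additive under concatenation, and disjointness of the
  \<open>W t\<close> keeps the sum at most \<open>1\<close>. A part may live in fewer variables than the
  whole, because the requirement on the sets \<open>Z\<close> is only an upper bound.
\<close>

lemma Stanley_decomposition_concat:
  fixes W :: "'t \<Rightarrow> (nat \<Rightarrow>\<^sub>0 nat) set"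
  assumes "distinct ts"
    and D: "\<And>t. t \<in> set ts \<Longrightarrow> Stanley_decomposition (X t) (mono_span (W t) :: 'k::field mpoly set) (D t)"
    and "\<And>t. t \<in> set ts \<Longrightarrow> X t \<subseteq> X'"
    and disj: "disjoint_family_on W (set ts)"
  shows "Stanley_decomposition X' (mono_span (\<Union>t\<in>set ts. W t) :: 'k mpoly set) (concat (map D ts))"
  using assms
proof (induction ts)
  case Nil
  show ?case by (simp add: Stanley_decomposition_mono_span_iff)
next
  case (Cons t ts)
  have "disjoint_family_on W (set ts)"
    using Cons.prems(4) by (auto simp: disjoint_family_on_def)
  with Cons have IH: "Stanley_decomposition X' (mono_span (\<Union>t\<in>set ts. W t) :: 'k mpoly set) (concat (map D ts))"
    by simp
  have t: "Stanley_decomposition (X t) (mono_span (W t) :: 'k mpoly set) (D t)" "X t \<subseteq> X'"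
    using Cons.prems(2,3)[of t] by simp_all
  have head: "u \<in> W t \<and> Z \<subseteq> X'" if "(u, Z) \<in> set (D t)" for u Z
    using t that unfolding Stanley_decomposition_mono_span_iff by blast
  have tail: "u \<in> (\<Union>t\<in>set ts. W t) \<and> Z \<subseteq> X'" if "(u, Z) \<in> set (concat (map D ts))" for u Z
    using IH that unfolding Stanley_decomposition_mono_span_iff by blast
  have head_count: "length (filter (\<lambda>d. w \<in> cone d) (D t)) = of_bool (w \<in> W t)" for w
    using t unfolding Stanley_decomposition_mono_span_iff by blast
  have tail_count: "length (filter (\<lambda>d. w \<in> cone d) (concat (map D ts)))
      = of_bool (w \<in> (\<Union>t\<in>set ts. W t))" for w
    using IH unfolding Stanley_decomposition_mono_span_iff by blast
  have split: "(\<Union>t\<in>set (t # ts). W t) = W t \<union> (\<Union>t\<in>set ts. W t)"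
    "concat (map D (t # ts)) = D t @ concat (map D ts)"
    by simp_all
  have excl: "W t \<inter> (\<Union>t\<in>set ts. W t) = {}"
    using Cons.prems(1,4) by (auto simp: disjoint_family_on_def)
  show ?case
    unfolding Stanley_decomposition_mono_span_iff split
  proof (intro conjI allI ballI)
    fix d assume d: "d \<in> set (D t @ concat (map D ts))"
    obtain u Z where uZ: "d = (u, Z)" by (cases d)
    from d show "case d of (u, Z) \<Rightarrow> u \<in> W t \<union> (\<Union>t\<in>set ts. W t) \<and> Z \<subseteq> X'"
      unfolding uZ set_append prod.case using head tail by blast
  next
    fix w
    show "length (filter (\<lambda>d. w \<in> cone d) (D t @ concat (map D ts)))
        = of_bool (w \<in> W t \<union> (\<Union>t\<in>set ts. W t))"
      using excl by (auto simp only: filter_append length_append head_count tail_count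
          of_bool_def Un_iff split: if_split)
  qed
qed

text \<open>
  A monomial lies in \<open>x\<^sub>F K[F]\<close> iff its support is exactly \<open>F\<close>, so that each monomial picks its
  summand.
\<close>

lemma Stanley_decomposition_sq_span_exists:
  assumes "finite X" "\<F> \<subseteq> Pow X"
  shows "\<exists>D. Stanley_decomposition X (sq_span \<F> :: 'k::field mpoly set) D"
proof -
  have "finite \<F>" using assms by (meson finite_Pow_iff finite_subset)
  then obtain Fs where Fs: "set Fs = \<F>" "distinct Fs" using finite_distinct_list by blast
  let ?D = "map (\<lambda>F. (sq_exp F, F)) Fs"
  have fin: "finite F" if "F \<in> \<F>" for F using that assms finite_subset by blast
  have cone_iff: "w \<in> cone (sq_exp F, F) \<longleftrightarrow> supp w = F" if "F \<in> \<F>" for w F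
  proof
    assume "w \<in> cone (sq_exp F, F)"
    then show "supp w = F" using fin[OF that] by (auto simp: cone_def supp_add supp_sq_exp)
  next
    assume F: "supp w = F"
    have "w = sq_exp F + (w - sq_exp F)"
      using F fin[OF that]
      by (intro poly_mapping_eqI) (auto simp: lookup_add lookup_minus lookup_sq_exp in_keys_iff)
    moreover have "supp (w - sq_exp F) \<subseteq> F"
      using F by (auto simp: in_keys_iff lookup_minus)
    ultimately show "w \<in> cone (sq_exp F, F)" by (auto simp: cone_def)
  qed
  have "length (filter (\<lambda>d. w \<in> cone d) ?D) = of_bool (supp w \<in> \<F>)" for w
  proof -
    have "length (filter (\<lambda>d. w \<in> cone d) ?D) = length (filter (\<lambda>F. supp w = F) Fs)"
      using cone_iff Fs(1) by (auto simp: filter_map o_def intro!: arg_cong[of _ _ length] filter_cong)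
    also have "\<dots> = card ({F. supp w = F} \<inter> \<F>)"
      using Fs by (simp add: distinct_length_filter)
    also have "{F. supp w = F} \<inter> \<F> = (if supp w \<in> \<F> then {supp w} else {})" by auto
    finally show ?thesis by simp
  qed
  then have "Stanley_decomposition X (sq_span \<F> :: 'k mpoly set) ?D"
    using assms Fs fin by (auto simp: sq_span_def Stanley_decomposition_mono_span_iff supp_sq_exp)
  then show ?thesis ..
qed

lemma decomposition_sdepth_ge_iff:
  assumes "D \<noteq> []"
  shows "m \<le> decomposition_sdepth D \<longleftrightarrow> (\<forall>(u, Z) \<in> set D. m \<le> card Z)"
  using assms by (auto simp: decomposition_sdepth_def)

text \<open>
  Nonemptiness of \<open>W\<close> excludes the empty decomposition, whose depth is the minimum of the empty
  set and hence unspecified.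
\<close>

lemma finite_decomposition_sdepths:
  assumes "finite X" "W \<noteq> {}"
  shows "finite {decomposition_sdepth D | D. Stanley_decomposition X (mono_span W :: 'k::field mpoly set) D}"
proof (rule finite_subset)
  show "{decomposition_sdepth D | D. Stanley_decomposition X (mono_span W :: 'k mpoly set) D} \<subseteq> {..card X}"
  proof
    fix d assume "d \<in> {decomposition_sdepth D | D. Stanley_decomposition X (mono_span W :: 'k mpoly set) D}"
    then obtain D where d: "d = decomposition_sdepth D"
      and D: "Stanley_decomposition X (mono_span W :: 'k mpoly set) D"
      by blast
    obtain w where "w \<in> W" using assms by blast
    with D have "D \<noteq> []" unfolding Stanley_decomposition_mono_span_iff by fastforce
    then obtain u Z where uZ: "(u, Z) \<in> set D" by (metis list.set_sel(1) surj_pair)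
    then have "decomposition_sdepth D \<le> card Z"
      by (force simp: decomposition_sdepth_def intro: Min_le)
    also have "\<dots> \<le> card X"
      using D uZ assms by (auto simp: Stanley_decomposition_def intro!: card_mono)
    finally show "d \<in> {..card X}" by (simp add: d)
  qed
qed simp

lemma sdepth_sq_span_attained:
  assumes "finite X" "\<F> \<subseteq> Pow X" "\<F> \<noteq> {}"
  obtains D where "Stanley_decomposition X (sq_span \<F> :: 'k::field mpoly set) D"
    "decomposition_sdepth D = sdepth X (sq_span \<F> :: 'k mpoly set)"
proof -
  let ?A = "{decomposition_sdepth D | D. Stanley_decomposition X (sq_span \<F> :: 'k mpoly set) D}"
  obtain F where F: "F \<in> \<F>" using assms by blast
  then have "finite F" using assms finite_subset by blast
  with F have "supp (sq_exp F) \<in> \<F>" by (simp add: supp_sq_exp)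
  then have "finite ?A"
    unfolding sq_span_def using assms(1) by (intro finite_decomposition_sdepths) auto
  moreover have "?A \<noteq> {}"
    using Stanley_decomposition_sq_span_exists[OF assms(1,2), where 'k = 'k] by blast
  ultimately have "Max ?A \<in> ?A" by (rule Max_in)
  then obtain D where "Stanley_decomposition X (sq_span \<F> :: 'k mpoly set) D"
    "decomposition_sdepth D = Max ?A"
    by auto
  then show ?thesis by (intro that) (simp_all add: sdepth_def)
qed

text \<open>
  Superadditivity: choose an optimal decomposition of every part and concatenate. The parts are
  required to be nonempty, as the Stanley depth of the zero ideal carries no information.
\<close>

lemma sdepth_ge_of_strata:
  assumes "finite X'" "finite T" "T \<noteq> {}"
    and X: "\<And>t. t \<in> T \<Longrightarrow> X t \<subseteq> X'"
    and \<F>: "\<And>t. t \<in> T \<Longrightarrow> \<F> t \<subseteq> Pow (X t)" "\<And>t. t \<in> T \<Longrightarrow> \<F> t \<noteq> {}"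
    and disj: "disjoint_family_on \<F> T"
    and m: "\<And>t. t \<in> T \<Longrightarrow> m \<le> sdepth (X t) (sq_span (\<F> t) :: 'k::field mpoly set)"
  shows "m \<le> sdepth X' (sq_span (\<Union>t\<in>T. \<F> t) :: 'k mpoly set)"
proof -
  define W where "W t = {u. supp u \<in> \<F> t}" for t
  have "\<exists>D. Stanley_decomposition (X t) (mono_span (W t) :: 'k mpoly set) D \<and> m \<le> decomposition_sdepth D"
    if t: "t \<in> T" for t
  proof -
    have "finite (X t)" using X[OF t] assms(1) finite_subset by blast
    from sdepth_sq_span_attained[OF this \<F>(1)[OF t] \<F>(2)[OF t], where 'k = 'k] m[OF t]
    show ?thesis by (metis W_def sq_span_def)
  qed
  then obtain D where D: "Stanley_decomposition (X t) (mono_span (W t) :: 'k mpoly set) (D t)"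
    "m \<le> decomposition_sdepth (D t)" if "t \<in> T" for t
    by metis
  obtain ts where ts: "set ts = T" "distinct ts" using assms(2) finite_distinct_list by blast
  let ?D = "concat (map D ts)"
  have "(\<Union>t\<in>T. W t) = {u. supp u \<in> (\<Union>t\<in>T. \<F> t)}" by (auto simp: W_def)
  moreover have "disjoint_family_on W (set ts)"
    using disj ts by (fastforce simp: disjoint_family_on_def W_def)
  ultimately have dec: "Stanley_decomposition X' (mono_span {u. supp u \<in> (\<Union>t\<in>T. \<F> t)} :: 'k mpoly set) ?D"
    using Stanley_decomposition_concat[OF ts(2), of X W D X', where 'k = 'k] D(1) X ts(1) by simp
  obtain t F where tF: "t \<in> T" "F \<in> \<F> t" using assms(3) \<F>(2) by blast
  then have "finite F" using \<F>(1) X assms(1) by (meson PowD finite_subset subsetD)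
  with tF have nonempty: "sq_exp F \<in> {u. supp u \<in> (\<Union>t\<in>T. \<F> t)}" by (auto simp: supp_sq_exp)
  with dec have "?D \<noteq> []" unfolding Stanley_decomposition_mono_span_iff by fastforce
  moreover have "m \<le> card Z" if "(u, Z) \<in> set ?D" for u Z
  proof -
    obtain t where "t \<in> T" "(u, Z) \<in> set (D t)" using \<open>(u, Z) \<in> set ?D\<close> ts(1) by auto
    moreover from this have "D t \<noteq> []" by auto
    ultimately show ?thesis using D(2)[of t] decomposition_sdepth_ge_iff[of "D t" m] by blast
  qed
  ultimately have "m \<le> decomposition_sdepth ?D" by (auto simp: decomposition_sdepth_ge_iff)
  also have "\<dots> \<le> sdepth X' (sq_span (\<Union>t\<in>T. \<F> t) :: 'k mpoly set)"
    unfolding sdepth_def sq_span_def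
  proof (rule Max_ge)
    show "finite {decomposition_sdepth D |D.
        Stanley_decomposition X' (mono_span {u. supp u \<in> (\<Union>t\<in>T. \<F> t)} :: 'k mpoly set) D}"
      using assms(1) nonempty by (intro finite_decomposition_sdepths) blast+
    show "decomposition_sdepth ?D \<in> {decomposition_sdepth D |D.
        Stanley_decomposition X' (mono_span {u. supp u \<in> (\<Union>t\<in>T. \<F> t)} :: 'k mpoly set) D}"
      using dec by blast
  qed
  finally show ?thesis .
qed


section \<open>The stratification of the monomials of the intersection\<close>

text \<open>
  The supports of the monomials in \<open>\<Inter>i. P\<^sub>i\<close> whose part in the first \<open>r\<close> variables misses exactly
  the \<open>A i\<close> with \<open>i \<in> \<tau>\<close>, that is, fails to lie in exactly these \<open>P\<^sub>i\<close>.
\<close>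

definition stratum :: "nat \<Rightarrow> nat \<Rightarrow> nat \<Rightarrow> (nat \<Rightarrow> nat set) \<Rightarrow> nat set \<Rightarrow> nat set set" where
  "stratum n r s A \<tau> = {F. F \<subseteq> {1..n} \<and> (\<forall>i\<in>{1..s}. F \<inter> A i \<noteq> {}) \<and>
     {i \<in> {1..s}. F \<inter> {1..r} \<inter> A i = {}} = \<tau>}"

text \<open>
  Every monomial of a sum of polynomials occurs in one of the summands, and the support of a
  variable is a single point; so \<open>x\<^sub>j\<close> lies in the sum only if it lies in one of the \<open>P i\<close>.
\<close>

lemma Var_in_sum_primes_iff:
  fixes P :: "nat \<Rightarrow> 'k::field mpoly set"
  assumes "finite \<tau>" and P: "\<And>i. i \<in> \<tau> \<Longrightarrow> P i = sq_span {F. F \<subseteq> X \<and> F \<inter> A i \<noteq> {}}"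
    and A: "\<And>i. i \<in> \<tau> \<Longrightarrow> A i \<subseteq> X"
  shows "Var j \<in> (\<Sum>i\<in>\<tau>. P i) \<longleftrightarrow> j \<in> (\<Union>i\<in>\<tau>. A i)"
proof
  assume "Var j \<in> (\<Sum>i\<in>\<tau>. P i)"
  then obtain p where p: "(Var j :: 'k mpoly) = (\<Sum>i\<in>\<tau>. p i)" "\<forall>i\<in>\<tau>. p i \<in> P i"
    using assms(1) by (auto simp: set_sum_alt)
  have "Poly_Mapping.single j 1 \<in> Poly_Mapping.keys (Var j :: 'k mpoly)"
    by (simp add: Var_def Monom_def)
  then obtain i where i: "i \<in> \<tau>" "Poly_Mapping.single j 1 \<in> Poly_Mapping.keys (p i)"
    using keys_sum[of p \<tau>] p(1) by auto
  have "supp (Poly_Mapping.single j 1) \<inter> A i \<noteq> {}"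
    using i p(2) P[OF i(1)] by (auto simp: mem_sq_span_iff simp del: keys_single)
  then show "j \<in> (\<Union>i\<in>\<tau>. A i)" using i by auto
next
  assume "j \<in> (\<Union>i\<in>\<tau>. A i)"
  then obtain i where i: "i \<in> \<tau>" "j \<in> A i" by blast
  define p where "p k = (if k = i then Var j else 0 :: 'k mpoly)" for k
  have "\<forall>k\<in>\<tau>. p k \<in> P k"
    using i A[OF i(1)] P by (auto simp: p_def mem_sq_span_iff Var_def Monom_def)
  moreover have "(\<Sum>k\<in>\<tau>. p k) = Var j" using i assms(1) by (simp add: p_def)
  ultimately show "Var j \<in> (\<Sum>i\<in>\<tau>. P i)"
    unfolding set_sum_alt[OF assms(1)] by (intro CollectI exI[of _ p] conjI) (rule sym)
qed

lemma INT_primes: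
  fixes P :: "nat \<Rightarrow> 'k::field mpoly set"
  assumes P: "\<And>i. i \<in> \<tau> \<Longrightarrow> P i = sq_span {F. F \<subseteq> X \<and> F \<inter> A i \<noteq> {}}" and "Y \<subseteq> X"
  shows "(\<Inter>i\<in>\<tau>. P i) \<inter> polys Y = sq_span {F. F \<subseteq> Y \<and> (\<forall>i\<in>\<tau>. F \<inter> A i \<noteq> {})}"
proof -
  have "(\<Inter>i\<in>\<tau>. P i) = (\<Inter>i\<in>\<tau>. sq_span {F. F \<subseteq> X \<and> F \<inter> A i \<noteq> {}})"
    using P by (intro INF_cong) auto
  with \<open>Y \<subseteq> X\<close> show ?thesis
    unfolding set_eq_iff Int_iff INT_iff mem_sq_span_iff polys_eq_sq_span by blast
qed

text \<open>
  The combinatorial core. \<open>R\<close> and \<open>H\<close> stand for the first \<open>r\<close> and the remaining variables, \<open>V\<close> for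
  the variables of \<open>S\<^sub>\<tau>\<close>. The left-hand side describes the supports of the monomials in \<open>I\<^sub>\<tau>\<close>, the
  right-hand side the stratum of \<open>\<tau>\<close>: if \<open>F \<inter> R\<close> misses \<open>A i\<close> for all \<open>i \<in> \<tau>\<close>, then
  \<open>F \<inter> R\<close> lies in \<open>V\<close>, and \<open>F\<close> can meet these \<open>A i\<close> only inside \<open>H\<close>.
\<close>

lemma stratum_split_iff:
  fixes A :: "'i \<Rightarrow> 'a set"
  assumes "R \<inter> H = {}" "\<tau> \<subseteq> T"
    and V_def: "V = R - (\<Union>i\<in>\<tau>. A i)"
  shows "F \<subseteq> V \<union> H \<and> (\<forall>i\<in>T - \<tau>. F \<inter> V \<inter> A i \<noteq> {}) \<and> (\<forall>i\<in>\<tau>. F \<inter> H \<inter> A i \<noteq> {}) \<longleftrightarrow>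
    F \<subseteq> R \<union> H \<and> (\<forall>i\<in>T. F \<inter> A i \<noteq> {}) \<and> {i \<in> T. F \<inter> R \<inter> A i = {}} = \<tau>"
    (is "?split \<longleftrightarrow> ?stratum")
proof
  assume split: ?split
  then have "F \<inter> R \<inter> A i = {}" if "i \<in> \<tau>" for i
    using that assms(1) unfolding V_def by blast
  moreover have "F \<inter> R \<inter> A i \<noteq> {}" if "i \<in> T - \<tau>" for i
    using that split unfolding V_def by blast
  ultimately have "{i \<in> T. F \<inter> R \<inter> A i = {}} = \<tau>" using assms(2) by blast
  moreover have "F \<inter> A i \<noteq> {}" if "i \<in> T" for i
    using that split by (cases "i \<in> \<tau>") blast+
  moreover have "F \<subseteq> R \<union> H" using split unfolding V_def by blast
  ultimately show ?stratum by blast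
next
  assume stratum: ?stratum
  then have miss: "F \<inter> R \<inter> A i = {}" if "i \<in> \<tau>" for i using that by blast
  then have FV: "F \<inter> R = F \<inter> V" unfolding V_def by blast
  have "F \<subseteq> V \<union> H" using stratum FV by blast
  moreover have "F \<inter> V \<inter> A i \<noteq> {}" if "i \<in> T - \<tau>" for i
    using that stratum unfolding FV[symmetric] by blast
  moreover have "F \<inter> H \<inter> A i \<noteq> {}" if "i \<in> \<tau>" for i
    using that stratum miss[OF that] assms(2) by blast
  ultimately show ?split by blast
qed

locale intersection_of_monomial_primes =
  fixes n r s :: nat and P :: "nat \<Rightarrow> 'k::field mpoly set" and A :: "nat \<Rightarrow> nat set"
  assumes rn: "r \<le> n"
    and A: "\<And>i. i \<in> {1..s} \<Longrightarrow> A i \<subseteq> {1..n}"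
    and P: "\<And>i. i \<in> {1..s} \<Longrightarrow> P i = sq_span {F. F \<subseteq> {1..n} \<and> F \<inter> A i \<noteq> {}}"
begin

lemma S_vars_eq:
  assumes \<tau>: "\<tau> \<subseteq> {1..s}"
  shows "S_vars r P \<tau> = {1..r} - (\<Union>i\<in>\<tau>. A i)"
proof -
  from \<tau> have "finite \<tau>" using finite_subset by blast
  then have "Var j \<in> (\<Sum>i\<in>\<tau>. P i) \<longleftrightarrow> j \<in> (\<Union>i\<in>\<tau>. A i)" for j
    by (rule Var_in_sum_primes_iff) (use \<tau> P A in blast)+
  then show ?thesis unfolding S_vars_def by blast
qed

lemma I_zero_eq: "I_zero n r (\<Inter>i\<in>{1..s}. P i) = sq_span (stratum n r s A {})"
proof -
  let ?\<G> = "{F. F \<subseteq> {1..r} \<and> (\<forall>i\<in>{1..s}. F \<inter> A i \<noteq> {})}"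
  have sub: "{1..r} \<subseteq> {1..n}" using rn by auto
  have "(\<Inter>i\<in>{1..s}. P i) \<inter> polys {1..r} = sq_span ?\<G>"
    using P sub by (rule INT_primes)
  then have "I_zero n r (\<Inter>i\<in>{1..s}. P i) = Idl\<^bsub>poly_ring {1..n}\<^esub> (sq_span ?\<G>)"
    by (simp only: I_zero_def)
  also have "\<dots> = sq_span {F. F \<subseteq> {1..n} \<and> F \<inter> {1..r} \<in> ?\<G>}"
    using sub by (rule genideal_sq_span) blast+
  also have "{F. F \<subseteq> {1..n} \<and> F \<inter> {1..r} \<in> ?\<G>} = stratum n r s A {}"
    unfolding stratum_def by blast
  finally show ?thesis .
qed

lemma J_ideal_eq:
  assumes "\<tau> \<subseteq> {1..s}"
  shows "J_ideal r s P \<tau> = sq_span {F. F \<subseteq> S_vars r P \<tau> \<and> (\<forall>i\<in>{1..s} - \<tau>. F \<inter> A i \<noteq> {})}"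
  unfolding J_ideal_def
proof (rule INT_primes)
  show "S_vars r P \<tau> \<subseteq> {1..n}" using rn by (auto simp: S_vars_def)
qed (use P in blast)

lemma L_ideal_eq:
  assumes "\<tau> \<subseteq> {1..s}"
  shows "L_ideal n r P \<tau> = sq_span {F. F \<subseteq> {r+1..n} \<and> (\<forall>i\<in>\<tau>. F \<inter> A i \<noteq> {})}"
  unfolding L_ideal_def
proof (rule INT_primes)
  show "{r+1..n} \<subseteq> {1..n}" by auto
qed (use P assms in blast)

lemma stratum_iff:
  assumes "\<tau> \<subseteq> {1..s}"
  shows "F \<in> stratum n r s A \<tau> \<longleftrightarrow> F \<subseteq> S_vars r P \<tau> \<union> {r+1..n} \<and>
    (\<forall>i\<in>{1..s} - \<tau>. F \<inter> S_vars r P \<tau> \<inter> A i \<noteq> {}) \<and> (\<forall>i\<in>\<tau>. F \<inter> {r+1..n} \<inter> A i \<noteq> {})"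
proof -
  have n: "{1..n} = {1..r} \<union> {r+1..n}" "{1..r} \<inter> {r+1..n} = {}" using rn by auto
  show ?thesis
    unfolding stratum_def mem_Collect_eq stratum_split_iff[OF n(2) assms S_vars_eq[OF assms]]
    unfolding n(1) by (rule refl)
qed

lemma I_tau_eq:
  assumes \<tau>: "\<tau> \<subseteq> {1..s}"
  shows "I_tau n r s P \<tau> = sq_span (stratum n r s A \<tau>)"
proof -
  let ?S = "S_vars r P \<tau>" and ?X = "S_vars r P \<tau> \<union> {r+1..n}"
  let ?J = "{F. F \<subseteq> ?S \<and> (\<forall>i\<in>{1..s} - \<tau>. F \<inter> A i \<noteq> {})}"
  let ?L = "{F. F \<subseteq> {r+1..n} \<and> (\<forall>i\<in>\<tau>. F \<inter> A i \<noteq> {})}"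
  have "Idl\<^bsub>poly_ring ?X\<^esub> (sq_span ?J :: 'k mpoly set) = sq_span {F. F \<subseteq> ?X \<and> F \<inter> ?S \<in> ?J}"
    by (rule genideal_sq_span) blast+
  moreover have "Idl\<^bsub>poly_ring ?X\<^esub> (sq_span ?L :: 'k mpoly set)
      = sq_span {F. F \<subseteq> ?X \<and> F \<inter> {r+1..n} \<in> ?L}"
    by (rule genideal_sq_span) blast+
  ultimately have "I_tau n r s P \<tau> =
      sq_span {F. F \<subseteq> ?X \<and> F \<inter> ?S \<in> ?J} \<inter> sq_span {F. F \<subseteq> ?X \<and> F \<inter> {r+1..n} \<in> ?L}"
    by (simp only: I_tau_def J_ideal_eq[OF \<tau>] L_ideal_eq[OF \<tau>])
  also have "\<dots> = sq_span (stratum n r s A \<tau>)"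
    unfolding set_eq_iff Int_iff mem_sq_span_iff stratum_iff[OF \<tau>] mem_Collect_eq by blast
  finally show ?thesis .
qed

text \<open>
  A monomial of the stratum splits into a monomial of \<open>J\<^sub>\<tau>\<close> and one of \<open>L\<^sub>\<tau>\<close>, so both are nonzero.
\<close>

lemma stratum_nonempty_imp_F_family:
  assumes \<tau>: "\<tau> \<subseteq> {1..s}" "\<tau> \<noteq> {}" and F: "F \<in> stratum n r s A \<tau>"
  shows "\<tau> \<in> F_family n r s P"
proof -
  let ?J = "{F. F \<subseteq> S_vars r P \<tau> \<and> (\<forall>i\<in>{1..s} - \<tau>. F \<inter> A i \<noteq> {})}"
  let ?L = "{F. F \<subseteq> {r+1..n} \<and> (\<forall>i\<in>\<tau>. F \<inter> A i \<noteq> {})}"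
  have JL: "F \<inter> S_vars r P \<tau> \<in> ?J" "F \<inter> {r+1..n} \<in> ?L"
    using F unfolding stratum_iff[OF \<tau>(1)] by blast+
  have "finite (F \<inter> S_vars r P \<tau>)" "finite (F \<inter> {r+1..n})" by (simp_all add: S_vars_def)
  then have "(sq_span ?J :: 'k mpoly set) \<noteq> {0}" "(sq_span ?L :: 'k mpoly set) \<noteq> {0}"
    using sq_span_nonzero[OF JL(1)] sq_span_nonzero[OF JL(2)] by blast+
  then have "J_ideal r s P \<tau> \<noteq> {0}" "L_ideal n r P \<tau> \<noteq> {0}"
    using J_ideal_eq[OF \<tau>(1)] L_ideal_eq[OF \<tau>(1)] by simp_all
  then show ?thesis using \<tau> unfolding F_family_def by blast
qed

end

lemma UN_stratum:
  "(\<Union>\<tau>\<in>{\<tau>. \<tau> \<subseteq> {1..s} \<and> stratum n r s A \<tau> \<noteq> {}}. stratum n r s A \<tau>)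
    = {F. F \<subseteq> {1..n} \<and> (\<forall>i\<in>{1..s}. F \<inter> A i \<noteq> {})}"
  unfolding stratum_def by blast

lemma disjoint_strata: "disjoint_family_on (stratum n r s A) T"
  unfolding disjoint_family_on_def stratum_def by blast

text \<open>
  If one of the sets is \<open>{0}\<close>, then the intersection is \<open>{0}\<close> whichever other one is omitted.
\<close>

lemma irredundant_nonzero:
  assumes "irredundant s P" "s \<ge> 2" "i \<in> {1..s}"
    and zero: "\<And>j. j \<in> {1..s} \<Longrightarrow> 0 \<in> P j"
  shows "P i \<noteq> {0}"
proof
  assume Pi: "P i = {0}"
  define j where "j = (if i = 1 then 2 else 1::nat)"
  have j: "j \<in> {1..s}" "j \<noteq> i" using assms(2,3) by (auto simp: j_def)
  have "(\<Inter>k\<in>{1..s} - {j}. P k) = {0}" "(\<Inter>k\<in>{1..s}. P k) = {0}"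
    using Pi zero j assms(3) by blast+
  with assms(1) j show False by (simp add: irredundant_def)
qed

theorem theorem1p6:
  fixes n r s :: nat
    and P :: "nat \<Rightarrow> 'k::field mpoly set"
    and I :: "'k mpoly set"
  assumes "s \<ge> 2"
    and "\<And>i. i \<in> {1..s} \<Longrightarrow> monomial_prime {1..n} (P i)"
    and "I = (\<Inter>i \<in> {1..s}. P i)"
    and "irredundant s P"
    and "(\<Sum>i \<in> {1..s}. P i) = Idl\<^bsub>poly_ring {1..n}\<^esub> (Var ` {1..n})"
    and "0 < r" and "r < n"
    and "\<exists>i \<in> {1..s}. \<exists>A \<subseteq> {1..r}. P i = Idl\<^bsub>poly_ring {1..n}\<^esub> (Var ` A)"
  shows "sdepth {1..n} I \<ge> Min ({A_zero n r I} \<union> A_tau n r s P ` F_family n r s P)"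
proof -
  have "\<exists>B \<subseteq> {1..n}. P i = Idl\<^bsub>poly_ring {1..n}\<^esub> (Var ` B)" if "i \<in> {1..s}" for i
    using assms(2)[OF that] by (simp add: monomial_prime_def)
  then obtain A where A: "\<And>i. i \<in> {1..s} \<Longrightarrow> A i \<subseteq> {1..n}"
    and PA: "\<And>i. i \<in> {1..s} \<Longrightarrow> P i = Idl\<^bsub>poly_ring {1..n}\<^esub> (Var ` A i)"
    by metis
  have P: "P i = sq_span {F. F \<subseteq> {1..n} \<and> F \<inter> A i \<noteq> {}}" if "i \<in> {1..s}" for i
    unfolding PA[OF that] by (rule genideal_Var[OF A[OF that]])
  have rn: "r \<le> n" using assms(7) by simp
  interpret intersection_of_monomial_primes n r s P A
    using rn A P by unfold_locales
  define strat where "strat = stratum n r s A"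
  define X where "X \<tau> = S_vars r P \<tau> \<union> {r+1..n}" for \<tau>
  define T where "T = {\<tau>. \<tau> \<subseteq> {1..s} \<and> strat \<tau> \<noteq> {}}"
  let ?m = "Min ({A_zero n r I} \<union> A_tau n r s P ` F_family n r s P)"
  have "finite (F_family n r s P)"
    by (rule finite_subset[of _ "Pow {1..s}"]) (auto simp: F_family_def)
  then have Min_le: "?m \<le> a" if "a \<in> {A_zero n r I} \<union> A_tau n r s P ` F_family n r s P" for a
    using that by (intro Min_le) auto
  \<comment> \<open>this makes \<open>x\<^sub>1 \<cdots> x\<^sub>n\<close> a monomial of \<open>I\<close>, so that at least one stratum is nonempty\<close>
  have A_nonempty: "{1..n} \<inter> A i \<noteq> {}" if "i \<in> {1..s}" for i
  proof -
    have "P i \<noteq> {0}"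
      using irredundant_nonzero[OF assms(4,1) that] by (simp add: P mem_sq_span_iff)
    then have "{F. F \<subseteq> {1..n} \<and> F \<inter> A i \<noteq> {}} \<noteq> {}"
      unfolding P[OF that] by (intro notI) (simp only: sq_span_empty)
    then show ?thesis by blast
  qed
  have I: "I = sq_span (\<Union>\<tau>\<in>T. strat \<tau>)"
  proof -
    have "1 \<in> {1..s}" using assms(1) by simp
    then have "I \<subseteq> polys {1..n}"
      unfolding assms(3) using P[of 1] by (fastforce simp: mem_sq_span_iff polys_def)
    then have "I = (\<Inter>i\<in>{1..s}. P i) \<inter> polys {1..n}" using assms(3) by blast
    also have "\<dots> = sq_span {F. F \<subseteq> {1..n} \<and> (\<forall>i\<in>{1..s}. F \<inter> A i \<noteq> {})}"
      using P subset_refl by (rule INT_primes)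
    finally show ?thesis unfolding T_def strat_def UN_stratum .
  qed
  have "?m \<le> sdepth {1..n} (sq_span (\<Union>\<tau>\<in>T. strat \<tau>) :: 'k mpoly set)"
  proof (rule sdepth_ge_of_strata[where X = X])
    show "finite T" by (rule finite_subset[of _ "Pow {1..s}"]) (auto simp: T_def)
    have "{1..n} \<in> (\<Union>\<tau>\<in>T. strat \<tau>)"
      unfolding T_def strat_def UN_stratum using A_nonempty by blast
    then show "T \<noteq> {}" by blast
    show "X \<tau> \<subseteq> {1..n}" for \<tau> using rn by (auto simp: X_def S_vars_def)
    show "strat \<tau> \<subseteq> Pow (X \<tau>)" if "\<tau> \<in> T" for \<tau>
      using that stratum_iff[where \<tau> = \<tau>] unfolding T_def strat_def X_def by blast
    show "strat \<tau> \<noteq> {}" if "\<tau> \<in> T" for \<tau> using that by (simp add: T_def)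
    show "disjoint_family_on strat T" unfolding strat_def by (rule disjoint_strata)
    show "?m \<le> sdepth (X \<tau>) (sq_span (strat \<tau>) :: 'k mpoly set)" if "\<tau> \<in> T" for \<tau>
    proof (cases "\<tau> = {}")
      case True
      \<comment> \<open>the sum of no ideals is \<open>{0}\<close>, hence \<open>X {}\<close> consists of all variables, as needed for \<open>I\<^sub>0\<close>\<close>
      have "{1..r} \<union> {r+1..n} = {1..n}" using rn by auto
      moreover have "S_vars r P {} = {1..r}" by (simp add: S_vars_eq)
      ultimately have X0: "X {} = {1..n}" by (simp only: X_def)
      have I0: "I_zero n r I = sq_span (strat {})"
        unfolding assms(3) strat_def by (rule I_zero_eq)
      have "I_zero n r I \<noteq> {0}"
      proof -
        obtain F where "F \<in> strat {}" using \<open>\<tau> \<in> T\<close> True by (auto simp: T_def)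
        moreover from this have "finite F" by (auto simp: strat_def stratum_def intro: finite_subset)
        ultimately show ?thesis unfolding I0 by (rule sq_span_nonzero)
      qed
      then have "sdepth (X \<tau>) (sq_span (strat \<tau>) :: 'k mpoly set) = A_zero n r I"
        unfolding A_zero_def True X0 I0 by (rule if_P[symmetric])
      then show ?thesis using Min_le[of "A_zero n r I"] by (simp only: Un_iff insert_iff simp_thms)
    next
      case False
      with that have "\<tau> \<in> F_family n r s P"
        using stratum_nonempty_imp_F_family[where \<tau> = \<tau>] unfolding T_def strat_def by blast
      then have "A_tau n r s P \<tau> \<in> {A_zero n r I} \<union> A_tau n r s P ` F_family n r s P" by blast
      then have "?m \<le> A_tau n r s P \<tau>" by (rule Min_le)
      moreover have "A_tau n r s P \<tau> = sdepth (X \<tau>) (sq_span (strat \<tau>) :: 'k mpoly set)"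
        using that I_tau_eq[where \<tau> = \<tau>] by (simp add: A_tau_def X_def T_def strat_def)
      ultimately show ?thesis by (simp only:)
    qed
  qed simp
  then show ?thesis unfolding I .
qed

end
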